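(* For any $0<\theta<r<t\le T$ and $x,w,z\in\mathbb{R}$, $$G_{t-r}(x-z)\,G_{t-\theta}(x-w)\le 8T^{\frac12}\big(1+e^{\frac1{16T}}\big)\big(1+(r-\theta)^{-\frac12}\big)\,G_{8T}(z-w)\,\Big(G_{t-r}(x-z)+G_{t-\theta}(x-w)\Big).$$
   Context: $G_t(x)=\frac{1}{\sqrt{2\pi t}}\exp\left(-\frac{|x|^2}{2t}\right)$, $t>0$, $x\in\mathbb{R}$, is the heat kernel. *)

theory Defs
  imports Complex_Main
begin

text \<open>The one-dimensional heat kernel; meaningful only for \<open>t > 0\<close>.\<close>

definition heat_kernel :: "real \<Rightarrow> real \<Rightarrow> real" where
  "heat_kernel t x = 1 / sqrt (2 * pi * t) * exp (- (\<bar>x\<bar>\<^sup>2 / (2 * t)))"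

end

theory Submission
  imports Defs
begin

text \<open>
  Write \<open>s = t - r\<close>, \<open>u = t - \<theta>\<close>, \<open>\<delta> = r - \<theta> = u - s\<close>, \<open>d = z - w = (x - w) - (x - z)\<close>,
  and abbreviate the two kernels by \<open>A = G\<^sub>s(x - z)\<close> and \<open>B = G\<^sub>u(x - w)\<close>.
  Since \<open>A * B = min A B * max A B \<le> min A B * (A + B)\<close>, it suffices that at least one of
  \<open>A\<close>, \<open>B\<close> lies below the constant \<open>C\<close> that multiplies \<open>A + B\<close>. The normalisation of
  \<open>G\<^bsub>8T\<^esub>\<close> cancels \<open>sqrt T\<close>, so up to a numerical factor
  \<open>C\<close> is \<open>(1 + exp (1 / (16 * T))) * (1 + 1 / sqrt \<delta>) * exp (- d\<^sup>2 / (16 * T))\<close>.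

  The kernel \<open>B\<close> has variance \<open>u > \<delta>\<close>, so it never exceeds \<open>1 / sqrt (2 * pi * \<delta>)\<close>; only \<open>A\<close>,
  whose variance \<open>s\<close> may be arbitrarily small, can be large. What remains is to find the
  Gaussian decay in \<open>d\<close>.
  If \<open>\<bar>d\<bar> \<le> 1\<close>, no decay is needed: \<open>exp (1 / (16 * T))\<close> in \<open>C\<close> compensates for
  \<open>exp (- d\<^sup>2 / (16 * T))\<close>, and \<open>B \<le> C\<close>.
  If \<open>\<bar>d\<bar> \<ge> 1\<close>, the triangle inequality makes one of \<open>\<bar>x - w\<bar>\<close>, \<open>\<bar>x - z\<bar>\<close> at least \<open>\<bar>d\<bar> / 2\<close>. In
  the first case \<open>B\<close> itself decays (\<open>heat_kernel_le_far\<close>). In the second case \<open>A\<close> does, and half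
  of its exponent absorbs the singular factor \<open>1 / sqrt s\<close> (\<open>heat_kernel_le_far_uniform\<close>).
\<close>

lemma heat_kernel_nonneg: "0 < t \<Longrightarrow> 0 \<le> heat_kernel t x"
  by (simp add: heat_kernel_def)

lemma heat_kernel_le_peak:
  assumes "0 < \<delta>" "\<delta> \<le> t"
  shows "heat_kernel t x \<le> 1 / sqrt (2 * pi * \<delta>) * exp (- (x\<^sup>2 / (2 * t)))"
  unfolding heat_kernel_def using assms
  by (auto intro!: mult_right_mono divide_left_mono)

lemma heat_kernel_le_far:
  assumes "0 < \<delta>" "\<delta> \<le> t" "t \<le> T" "d\<^sup>2 \<le> 4 * x\<^sup>2"
  shows "heat_kernel t x \<le> 1 / sqrt (2 * pi * \<delta>) * exp (- (d\<^sup>2 / (16 * T)))"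
proof -
  have "d\<^sup>2 / (16 * T) \<le> (8 * x\<^sup>2) / (16 * t)"
    using assms zero_le_power2[of x] by (intro frac_le) (simp, linarith, auto)
  hence "exp (- (x\<^sup>2 / (2 * t))) \<le> exp (- (d\<^sup>2 / (16 * T)))"
    by simp
  thus ?thesis
    using heat_kernel_le_peak[OF assms(1,2), of x] assms(1)
    by (meson mult_left_mono order_trans divide_nonneg_nonneg real_sqrt_ge_zero
        mult_nonneg_nonneg pi_ge_zero zero_le_numeral zero_le_one less_imp_le)
qed

text \<open>
  This is the inequality \<open>sqrt y * exp (- y) \<le> 1 / 2\<close> at \<open>y = 1 / (16 * s)\<close>, which follows from
  \<open>exp y \<ge> 1 + y \<ge> 2 * sqrt y\<close>.
\<close>

lemma exp_neg_inverse_le_sqrt: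
  fixes s :: real
  assumes "0 < s"
  shows "exp (- (1 / (16 * s))) \<le> 2 * sqrt s"
proof -
  have "0 \<le> (4 * sqrt s - 1)\<^sup>2" by simp
  hence "8 * sqrt s \<le> 16 * s + 1"
    using assms by (simp add: power2_diff power_mult_distrib)
  hence "sqrt s * (8 * sqrt s) \<le> sqrt s * (16 * s + 1)"
    using assms by (intro mult_left_mono) auto
  hence "8 * s \<le> sqrt s * (16 * s + 1)"
    using assms by (simp add: mult.left_commute[of "sqrt s" 8])
  hence "1 \<le> 2 * sqrt s * (1 + 1 / (16 * s))"
    using assms by (simp add: field_simps)
  also have "\<dots> \<le> 2 * sqrt s * exp (1 / (16 * s))"
    using assms exp_ge_add_one_self[of "1 / (16 * s)"] by (intro mult_left_mono) auto
  finally show ?thesis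
    by (simp add: exp_minus field_simps)
qed

text \<open>
  Away from the origin the heat kernel stays bounded as \<open>s\<close> tends to \<open>0\<close>. With \<open>\<bar>x\<bar> \<ge> \<bar>d\<bar> / 2\<close> the
  Gaussian exponent is at least \<open>d\<^sup>2 / (8 * s)\<close>: one half, where \<open>d\<^sup>2 \<ge> 1\<close>, beats \<open>1 / sqrt s\<close>, and
  the other half is the decay in the conclusion.
\<close>

lemma heat_kernel_le_far_uniform:
  assumes "0 < s" "s \<le> T" "1 \<le> d\<^sup>2" "d\<^sup>2 \<le> 4 * x\<^sup>2"
  shows "heat_kernel s x \<le> 2 / sqrt (2 * pi) * exp (- (d\<^sup>2 / (16 * T)))"
proof -
  have "d\<^sup>2 / (16 * T) \<le> d\<^sup>2 / (16 * s)"
    using assms by (intro divide_left_mono) auto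
  moreover have "1 / (16 * s) \<le> d\<^sup>2 / (16 * s)"
    using assms by (intro divide_right_mono) auto
  moreover have "d\<^sup>2 / (16 * s) + d\<^sup>2 / (16 * s) \<le> x\<^sup>2 / (2 * s)"
    using assms by (simp add: field_simps)
  ultimately have "- (x\<^sup>2 / (2 * s)) \<le> - (1 / (16 * s)) + - (d\<^sup>2 / (16 * T))"
    by linarith
  hence "exp (- (x\<^sup>2 / (2 * s))) \<le> exp (- (1 / (16 * s)) + - (d\<^sup>2 / (16 * T)))"
    by (simp only: exp_le_cancel_iff)
  also have "\<dots> = exp (- (1 / (16 * s))) * exp (- (d\<^sup>2 / (16 * T)))"
    by (rule exp_add)
  also have "\<dots> \<le> 2 * sqrt s * exp (- (d\<^sup>2 / (16 * T)))"
    using exp_neg_inverse_le_sqrt[OF assms(1)] by (intro mult_right_mono) auto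
  finally have "1 / sqrt (2 * pi * s) * exp (- (x\<^sup>2 / (2 * s)))
      \<le> 1 / sqrt (2 * pi * s) * (2 * sqrt s * exp (- (d\<^sup>2 / (16 * T))))"
    using assms by (intro mult_left_mono) auto
  also have "\<dots> = 2 / sqrt (2 * pi) * exp (- (d\<^sup>2 / (16 * T)))"
    using assms by (simp add: real_sqrt_mult)
  finally show ?thesis
    by (simp add: heat_kernel_def)
qed

lemma mult_le_mult_add_if_one_le:
  fixes A B C :: real
  assumes "0 \<le> A" "0 \<le> B" "A \<le> C \<or> B \<le> C"
  shows "A * B \<le> C * (A + B)"
  using assms(3)
proof
  assume "A \<le> C"
  hence "A * B \<le> C * B" "0 \<le> C * A"
    using assms by (auto intro: mult_right_mono)
  thus ?thesis by (simp add: algebra_simps)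
next
  assume "B \<le> C"
  hence "B * A \<le> C * A" "0 \<le> C * B"
    using assms by (auto intro: mult_right_mono)
  thus ?thesis by (simp add: algebra_simps)
qed

theorem lemma3p3:
  fixes \<theta> r t T x w z :: real
  assumes "0 < \<theta>" and "\<theta> < r" and "r < t" and "t \<le> T"
  shows "heat_kernel (t - r) (x - z) * heat_kernel (t - \<theta>) (x - w)
    \<le> 8 * T powr (1 / 2) * (1 + exp (1 / (16 * T))) * (1 + (r - \<theta>) powr (- (1 / 2)))
        * heat_kernel (8 * T) (z - w)
        * (heat_kernel (t - r) (x - z) + heat_kernel (t - \<theta>) (x - w))"
proof -
  define A where "A = heat_kernel (t - r) (x - z)"
  define B where "B = heat_kernel (t - \<theta>) (x - w)"
  define \<delta> where "\<delta> = r - \<theta>"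
  define d where "d = z - w"
  define q where "q = 1 / sqrt \<delta>"
  define p where "p = 1 / sqrt (2 * pi)"
  define D where "D = exp (- (d\<^sup>2 / (16 * T)))"
  define M where "M = 1 + exp (1 / (16 * T))"
  define C where "C = 8 * T powr (1 / 2) * M * (1 + \<delta> powr (- (1 / 2))) * heat_kernel (8 * T) d"
  have T: "0 < T" and \<delta>: "0 < \<delta>" "\<delta> \<le> t - \<theta>" "t - \<theta> \<le> T"
    using assms by (auto simp: \<delta>_def)
  have pos: "0 < q" "0 < p" "0 < D" "1 \<le> M"
    using \<delta> by (auto simp: q_def p_def D_def M_def)
  have peak: "1 / sqrt (2 * pi * \<delta>) = p * q"
    by (simp add: p_def q_def real_sqrt_mult)

  \<comment> \<open>The exact value is \<open>C = 2 / sqrt pi * M * (1 + q) * D\<close>; a factor \<open>sqrt 2\<close> is given away so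
    that the same \<open>p\<close> occurs in \<open>C\<close> and in the bounds on \<open>A\<close> and \<open>B\<close>.\<close>
  have "8 * sqrt T / sqrt (16 * pi * T) = 2 / sqrt pi"
    using T by (simp add: real_sqrt_mult)
  moreover have "C = 8 * sqrt T / sqrt (16 * pi * T) * (M * (1 + q) * D)"
    using T \<delta> by (simp add: C_def D_def q_def heat_kernel_def powr_half_sqrt powr_minus
        inverse_eq_divide mult_ac)
  ultimately have "C = 2 / sqrt pi * (M * (1 + q) * D)"
    by (simp only:)
  moreover have "2 * p \<le> 2 / sqrt pi"
    unfolding p_def by (simp add: divide_simps)
  ultimately have C: "2 * p * (M * (1 + q) * D) \<le> C"
    using pos by (simp only:) (intro mult_right_mono mult_nonneg_nonneg, auto)
  have C': "2 * p * ((1 + q) * D) \<le> C"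
  proof -
    have "1 * ((1 + q) * D) \<le> M * ((1 + q) * D)"
      using pos by (intro mult_right_mono) auto
    hence "2 * p * ((1 + q) * D) \<le> 2 * p * (M * (1 + q) * D)"
      using pos by (intro mult_left_mono) (auto simp: mult.assoc)
    thus ?thesis using C by linarith
  qed

  have "A \<le> C \<or> B \<le> C"
  proof (cases "d\<^sup>2 \<le> 1")
    case True
    have "B \<le> p * q * exp (- ((x - w)\<^sup>2 / (2 * (t - \<theta>))))"
      unfolding B_def using heat_kernel_le_peak[OF \<delta>(1,2), of "x - w"] by (simp only: peak)
    also have "\<dots> \<le> p * q * 1"
      using pos \<delta> by (intro mult_left_mono) auto
    also have "\<dots> \<le> 2 * p * (1 + q) * 1"
      using pos by (simp add: algebra_simps)
    also have "\<dots> \<le> 2 * p * (1 + q) * (M * D)"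
    proof (intro mult_left_mono)
      have "d\<^sup>2 / (16 * T) \<le> 1 / (16 * T)"
        using True T by (intro divide_right_mono) auto
      hence "1 \<le> exp (1 / (16 * T)) * D"
        by (simp add: D_def flip: exp_add)
      thus "1 \<le> M * D"
        using pos by (simp add: M_def algebra_simps)
    qed (use pos in auto)
    also have "\<dots> \<le> C"
      using C by (simp add: mult_ac)
    finally show ?thesis ..
  next
    case False
    show ?thesis
    proof (cases "d\<^sup>2 \<le> 4 * (x - w)\<^sup>2")
      case True
      have "B \<le> p * q * D"
        unfolding B_def D_def using heat_kernel_le_far[OF \<delta> True] by (simp only: peak)
      also have "\<dots> \<le> 2 * p * ((1 + q) * D)"
        using pos by (simp add: algebra_simps)
      finally show ?thesis using C' by linarith
    next
      case near_w: False
      have "\<bar>d\<bar> \<le> \<bar>2 * (x - z)\<bar>"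
      proof -
        have "(2 * (x - w))\<^sup>2 \<le> d\<^sup>2"
          unfolding power_mult_distrib using near_w by simp
        hence "\<bar>2 * (x - w)\<bar> \<le> \<bar>d\<bar>"
          by (simp only: abs_le_square_iff)
        thus ?thesis by (simp add: d_def)
      qed
      hence "d\<^sup>2 \<le> 4 * (x - z)\<^sup>2"
        unfolding abs_le_square_iff power_mult_distrib by simp
      hence "A \<le> 2 * p * D"
        unfolding A_def D_def p_def
        using heat_kernel_le_far_uniform[of "t - r" T d "x - z"] assms False by simp
      also have "\<dots> \<le> 2 * p * ((1 + q) * D)"
        using pos by (simp add: algebra_simps)
      finally show ?thesis using C' by linarith
    qed
  qed
  moreover have "0 \<le> A" "0 \<le> B"
    using assms by (auto simp: A_def B_def intro: heat_kernel_nonneg)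
  ultimately have "A * B \<le> C * (A + B)"
    by (intro mult_le_mult_add_if_one_le)
  thus ?thesis
    by (simp only: A_def B_def C_def M_def \<delta>_def d_def)
qed

end
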